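(* Let $N\ge 2$ be an integer, let $A, T_s, v^{\rm m}, \lambda, \sigma^2, P, |\beta|$ be positive reals, and put $\Delta := v^{\rm m}T_s$. Suppose $A \ge (N-1)\Delta$ (the time-constrained regime). Call a pair $(\bm{x},\bm{v})$ with $\bm{x}=[x_1,\dots,x_N]^{\mathsf T}\in\mathbb{R}^N$, $\bm{v}=[v_1,\dots,v_{N-1}]^{\mathsf T}\in\mathbb{R}^{N-1}$ feasible if $-v^{\rm m}\le v_n\le v^{\rm m}$ for $n=1,\dots,N-1$, $0\le x_n\le A$ for $n=1,\dots,N$, and $x_n = x_1+T_s\sum_{m=1}^{n-1}v_m$ for $n=2,\dots,N$. Then an optimal velocity vector, i.e. one that (together with the positions below) minimizes ${\rm CRB}_u(\bm{x})$ over all feasible pairs, is $$v_n^{\rm TC}=v^{\rm m},\qquad n=1,\dots,N-1,$$ with corresponding position vector $$x_n^{\rm TC}=x_1^{\rm TC}+(n-1)\Delta,\qquad n=2,\dots,N,$$ where $x_1^{\rm TC}$ is any real number satisfying $0\le x_1^{\rm TC}\le A-(N-1)\Delta$. The resulting minimum value is $${\rm CRB}_u(\bm{x}^{\rm TC})=\frac{3\sigma^2\lambda^2}{2\pi^2P|\beta|^2\Delta^2}\,\frac{1}{N(N^2-1)},$$ which decreases with $N$ in the order of $\mathcal{O}(N^{-3})$ (the parameters $\sigma^2,\lambda,P,|\beta|,\Delta$ being fixed).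
   Context: A single movable antenna moves along the line segment $[0,A]$; $x_n$ is its position at the $n$th of $N$ snapshots, $v_n$ its velocity between snapshots $n$ and $n+1$, $T_s$ the time between snapshots, and $v^{\rm m}$ the maximum speed. The constants $\lambda$ (wavelength), $\sigma^2$ (noise power), $P$ (signal power), $|\beta|$ (channel gain magnitude) are positive. For $\bm{x}\in\mathbb{R}^N$ define $\mu(\bm{x})=\frac1N\sum_{n=1}^N x_n$ and ${\rm var}(\bm{x})=\frac1N\sum_{n=1}^N x_n^2-\mu(\bm{x})^2$. The Cramér–Rao bound for estimating the spatial angle of arrival $u$ is the function $${\rm CRB}_u(\bm{x})=\frac{\sigma^2\lambda^2}{8\pi^2PN|\beta|^2}\,\frac{1}{{\rm var}(\bm{x})},$$ with the convention ${\rm CRB}_u(\bm{x})=+\infty$ when ${\rm var}(\bm{x})=0$; minimizing ${\rm CRB}_u$ is equivalent to maximizing ${\rm var}(\bm{x})$. *)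

theory Defs
  imports "HOL-Analysis.Analysis" "HOL-Library.Landau_Symbols"
begin

text \<open>
  The number of snapshots \<open>N\<close> varies in the asymptotic claim, so vectors in \<open>\<real>\<^sup>N\<close> are functions
  \<open>nat \<Rightarrow> real\<close> of which only the values at the indices \<open>1, \<dots>, N\<close> are ever inspected.
  The variables \<open>\<sigma>sq\<close> and \<open>\<beta>abs\<close> stand for the noise power \<open>\<sigma>\<^sup>2\<close> and the gain magnitude
  \<open>\<bar>\<beta>\<bar>\<close>; \<open>wl\<close> is the wavelength.
\<close>

definition pos_mean :: "nat \<Rightarrow> (nat \<Rightarrow> real) \<Rightarrow> real" where
  "pos_mean N x = 1 / real N * (\<Sum>n=1..N. x n)"

definition pos_var :: "nat \<Rightarrow> (nat \<Rightarrow> real) \<Rightarrow> real" where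
  "pos_var N x = 1 / real N * (\<Sum>n=1..N. (x n)\<^sup>2) - (pos_mean N x)\<^sup>2"

definition CRB :: "real \<Rightarrow> real \<Rightarrow> real \<Rightarrow> real \<Rightarrow> nat \<Rightarrow> (nat \<Rightarrow> real) \<Rightarrow> ereal" where
  "CRB \<sigma>sq wl P \<beta>abs N x =
     (if pos_var N x = 0 then \<infinity>
      else ereal (\<sigma>sq * wl\<^sup>2 / (8 * pi\<^sup>2 * P * real N * \<beta>abs\<^sup>2) * (1 / pos_var N x)))"

definition feasible ::
  "real \<Rightarrow> real \<Rightarrow> real \<Rightarrow> nat \<Rightarrow> (nat \<Rightarrow> real) \<Rightarrow> (nat \<Rightarrow> real) \<Rightarrow> bool" where
  "feasible A Ts vm N x v \<longleftrightarrow>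
     (\<forall>n\<in>{1..N-1}. - vm \<le> v n \<and> v n \<le> vm) \<and>
     (\<forall>n\<in>{1..N}. 0 \<le> x n \<and> x n \<le> A) \<and>
     (\<forall>n\<in>{2..N}. x n = x 1 + Ts * (\<Sum>m=1..n-1. v m))"

definition v_TC :: "real \<Rightarrow> nat \<Rightarrow> real" where
  "v_TC vm = (\<lambda>n. vm)"

definition x_TC :: "real \<Rightarrow> real \<Rightarrow> nat \<Rightarrow> real" where
  "x_TC x1 \<Delta> = (\<lambda>n. x1 + (real n - 1) * \<Delta>)"

end

theory Submission
  imports Defs
begin

text \<open>
  The variance equals \<open>1/(2 N\<^sup>2)\<close> times the sum of all \<open>(x\<^sub>i - x\<^sub>j)\<^sup>2\<close>. The speed limit
  gives \<open>\<bar>x\<^sub>i - x\<^sub>j\<bar> \<le> \<bar>i - j\<bar> \<Delta>\<close> for every feasible trajectory, and motion at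
  full speed attains equality for all pairs at once; hence it maximises the variance, whose value is
  then \<open>\<Delta>\<^sup>2 (N\<^sup>2 - 1) / 12\<close>.
\<close>

text \<open>Expand the square: each of the two square terms is constant in one index and yields a
  factor \<open>card I\<close>, while the cross terms factor into the square of the sum.\<close>

lemma sum_sum_diff_squared:
  fixes x :: "'a \<Rightarrow> real"
  shows "(\<Sum>i\<in>I. \<Sum>j\<in>I. (x i - x j)\<^sup>2) = 2 * (real (card I) * (\<Sum>i\<in>I. (x i)\<^sup>2) - (\<Sum>i\<in>I. x i)\<^sup>2)"
  by (simp add: power2_diff sum.distrib sum_subtractf power2_eq_square[of "sum x I"] sum_product
      mult.assoc flip: sum_distrib_left)

lemma pos_var_eq_sum_pairs:
  assumes "N > 0"
  shows "pos_var N x = (\<Sum>i=1..N. \<Sum>j=1..N. (x i - x j)\<^sup>2) / (2 * (real N)\<^sup>2)"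
  unfolding sum_sum_diff_squared pos_var_def pos_mean_def
  using assms by (simp add: field_simps power2_eq_square)

lemma sum_x_TC: "(\<Sum>n=1..N. x_TC s \<Delta> n) = real N * s + \<Delta> * real N * (real N - 1) / 2"
  by (induction N) (auto simp: x_TC_def field_simps)

lemma sum_x_TC_squared:
  "(\<Sum>n=1..N. (x_TC s \<Delta> n)\<^sup>2) =
     real N * s\<^sup>2 + s * \<Delta> * real N * (real N - 1) + \<Delta>\<^sup>2 * real N * (real N - 1) * (2 * real N - 1) / 6"
  by (induction N) (auto simp: x_TC_def field_simps power2_eq_square)

lemma pos_var_x_TC:
  assumes "N > 0"
  shows "pos_var N (x_TC s \<Delta>) = \<Delta>\<^sup>2 * ((real N)\<^sup>2 - 1) / 12"
  unfolding pos_var_def pos_mean_def sum_x_TC sum_x_TC_squared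
  using assms by (simp add: field_simps power2_eq_square)

text \<open>One time step moves the antenna by \<open>Ts * v k\<close>, hence by at most
  \<open>vm * Ts\<close>; the triangle inequality adds up consecutive steps.\<close>

lemma feasible_dist_le:
  assumes feas: "feasible A Ts vm N x v" and "Ts > 0" and "m \<in> {1..N}" and "n \<in> {1..N}"
  shows "\<bar>x n - x m\<bar> \<le> \<bar>real n - real m\<bar> * (vm * Ts)"
proof -
  \<comment> \<open>Feasibility gives this formula only from index 2 on; at \<open>k = 1\<close> the
    sum is empty.\<close>
  have x_eq: "x k = x 1 + Ts * (\<Sum>j=1..k-1. v j)" if "k \<in> {1..N}" for k
    using feas that by (cases "k = 1") (auto simp: feasible_def)
  have speed: "\<bar>x (Suc k) - x k\<bar> \<le> vm * Ts" if "1 \<le> k" "Suc k \<le> N" for k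
  proof -
    have "{1..k} = insert k {1..k-1}"
      using that by auto
    then have "(\<Sum>j=1..k. v j) = v k + (\<Sum>j=1..k-1. v j)"
      using that by simp
    then have "x (Suc k) - x k = Ts * v k"
      using x_eq[of "Suc k"] x_eq[of k] that by (simp add: algebra_simps)
    moreover have "k \<in> {1..N-1}"
      using that by simp
    then have "\<bar>v k\<bar> \<le> vm"
      using feas unfolding feasible_def abs_le_iff by fastforce
    ultimately show ?thesis
      using \<open>Ts > 0\<close> by (simp add: abs_mult)
  qed
  \<comment> \<open>Ordered indices allow induction on the later one; the other order follows by
    symmetry of the absolute value.\<close>
  have le: "\<bar>x b - x a\<bar> \<le> (real b - real a) * (vm * Ts)" if "a \<le> b" "1 \<le> a" "b \<le> N" for a b
    using that
  proof (induction b rule: dec_induct)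
    case (step k)
    then have "\<bar>x k - x a\<bar> \<le> (real k - real a) * (vm * Ts)" by simp
    moreover have "\<bar>x (Suc k) - x k\<bar> \<le> vm * Ts"
      using speed step by simp
    ultimately show ?case by (simp add: algebra_simps)
  qed simp
  show ?thesis
    using le[of m n] le[of n m] assms(3,4) by (cases "m \<le> n") (auto simp: abs_minus_commute)
qed

text \<open>The comparison is made pair by pair and sees only differences of positions, so the start
  \<open>s\<close> is arbitrary.\<close>

lemma feasible_pos_var_le:
  assumes "feasible A Ts vm N x v" "Ts > 0" "N > 0"
  shows "pos_var N x \<le> pos_var N (x_TC s (vm * Ts))"
proof -
  have "(x i - x j)\<^sup>2 \<le> (x_TC s (vm * Ts) i - x_TC s (vm * Ts) j)\<^sup>2"
    if "i \<in> {1..N}" "j \<in> {1..N}" for i j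
  proof -
    have "\<bar>x i - x j\<bar> \<le> \<bar>real i - real j\<bar> * (vm * Ts)"
      using feasible_dist_le assms that by blast
    \<comment> \<open>The sign of \<open>vm * Ts\<close> is not fixed here, so it is bounded by its
      absolute value.\<close>
    also have "\<dots> \<le> \<bar>(real i - real j) * (vm * Ts)\<bar>"
      unfolding abs_mult[of "real i - real j"] by (intro mult_left_mono) auto
    also have "(real i - real j) * (vm * Ts) = x_TC s (vm * Ts) i - x_TC s (vm * Ts) j"
      by (simp add: x_TC_def algebra_simps)
    finally show ?thesis by (simp add: abs_le_square_iff)
  qed
  then show ?thesis
    unfolding pos_var_eq_sum_pairs[OF \<open>N > 0\<close>] by (intro divide_right_mono sum_mono) auto
qed

text \<open>If \<open>x\<close> has zero variance, its bound is infinite; otherwise the sum over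
  pairs shows that its variance is positive, and reciprocals reverse the order.\<close>

lemma CRB_antimono:
  assumes "\<sigma>sq > 0" "P > 0" and "pos_var N x \<le> pos_var N y" and "pos_var N y > 0" and "N > 0"
  shows "CRB \<sigma>sq wl P \<beta>abs N y \<le> CRB \<sigma>sq wl P \<beta>abs N x"
proof (cases "pos_var N x = 0")
  case False
  have "pos_var N x \<ge> 0"
    unfolding pos_var_eq_sum_pairs[OF \<open>N > 0\<close>] by (intro divide_nonneg_nonneg sum_nonneg) auto
  with False have "1 / pos_var N y \<le> 1 / pos_var N x"
    using assms by (simp add: frac_le)
  moreover have "\<sigma>sq * wl\<^sup>2 / (8 * pi\<^sup>2 * P * real N * \<beta>abs\<^sup>2) \<ge> 0"
    using assms by simp
  ultimately have "\<sigma>sq * wl\<^sup>2 / (8 * pi\<^sup>2 * P * real N * \<beta>abs\<^sup>2) * (1 / pos_var N y)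
      \<le> \<sigma>sq * wl\<^sup>2 / (8 * pi\<^sup>2 * P * real N * \<beta>abs\<^sup>2) * (1 / pos_var N x)"
    by (rule mult_left_mono)
  then show ?thesis
    using False assms unfolding CRB_def by simp
qed (simp add: CRB_def)

text \<open>The variance is nonzero, so the finite branch applies; the factor 3/2 is 12/8.\<close>

lemma CRB_x_TC:
  assumes "N \<ge> 2" "\<Delta> \<noteq> 0"
  shows "CRB \<sigma>sq wl P \<beta>abs N (x_TC s \<Delta>) =
    ereal (3 * \<sigma>sq * wl\<^sup>2 / (2 * pi\<^sup>2 * P * \<beta>abs\<^sup>2 * \<Delta>\<^sup>2) * (1 / (real N * ((real N)\<^sup>2 - 1))))"
proof -
  have "(real N)\<^sup>2 > 1" using assms by (intro one_less_power) auto
  then have "(real N)\<^sup>2 \<noteq> 1" by simp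
  then show ?thesis
    using assms by (auto simp: CRB_def pos_var_x_TC divide_simps)
qed

text \<open>Positions increase with the index, so the bounds on the first and last position
  suffice.\<close>

lemma feasible_x_TC:
  assumes "vm > 0" "Ts > 0" "\<Delta> = vm * Ts" "0 \<le> s" "s \<le> A - (real N - 1) * \<Delta>"
  shows "feasible A Ts vm N (x_TC s \<Delta>) (v_TC vm)"
proof -
  have "0 \<le> s + (real n - 1) * \<Delta> \<and> s + (real n - 1) * \<Delta> \<le> A" if "n \<in> {1..N}" for n
  proof -
    have "(real n - 1) * \<Delta> \<le> (real N - 1) * \<Delta>" "0 \<le> (real n - 1) * \<Delta>"
      using assms that by (auto intro: mult_right_mono)
    then show ?thesis using assms by linarith
  qed
  then show ?thesis
    using assms by (auto simp: feasible_def x_TC_def v_TC_def of_nat_diff algebra_simps)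
qed

text \<open>From 2 on, both factors of the denominator are positive and increasing. At 1 the
  denominator vanishes and the quotient is 0 by convention, which would break the decrease.\<close>

lemma strict_antimono_on_inverse_cubic:
  assumes "C > 0"
  shows "strict_antimono_on {2..} (\<lambda>M. C * (1 / (real M * ((real M)\<^sup>2 - 1))))"
proof (intro monotone_onI)
  fix a b :: nat
  assume "a \<in> {2..}" "a < b"
  then have "(real a)\<^sup>2 < (real b)\<^sup>2" "(real a)\<^sup>2 > 1"
    by (auto intro!: power_strict_mono one_less_power)
  then have "real a * ((real a)\<^sup>2 - 1) < real b * ((real b)\<^sup>2 - 1)" "real a * ((real a)\<^sup>2 - 1) > 0"
    using \<open>a < b\<close> \<open>a \<in> {2..}\<close> by (auto intro!: mult_strict_mono mult_pos_pos)
  then show "C * (1 / (real a * ((real a)\<^sup>2 - 1))) > C * (1 / (real b * ((real b)\<^sup>2 - 1)))"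
    using assms by (intro mult_strict_left_mono frac_less2) auto
qed

lemma inverse_cubic_bigo: "(\<lambda>M. C * (1 / (real M * ((real M)\<^sup>2 - 1)))) \<in> O(\<lambda>M. 1 / real M ^ 3)"
proof (rule bigoI)
  \<comment> \<open>The factor 2 works because \<open>M \<ge> 2\<close> gives
    \<open>M^2 \<ge> 4\<close>, hence \<open>M^2 \<le> 2 * (M^2 - 1)\<close>.\<close>
  show "\<forall>\<^sub>F M in at_top. norm (C * (1 / (real M * ((real M)\<^sup>2 - 1)))) \<le> (\<bar>C\<bar> * 2) * norm (1 / real M ^ 3)"
    using eventually_ge_at_top[of 2]
  proof eventually_elim
    case (elim M)
    then have "(real M)\<^sup>2 \<ge> 2\<^sup>2" by (intro power_mono) auto
    then have "real M * (real M)\<^sup>2 \<le> real M * (2 * ((real M)\<^sup>2 - 1))" and pos: "(real M)\<^sup>2 - 1 > 0"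
      by (auto intro!: mult_left_mono)
    then have "1 / (real M * ((real M)\<^sup>2 - 1)) \<le> 2 * (1 / real M ^ 3)"
      using elim by (simp add: divide_simps power3_eq_cube power2_eq_square mult.assoc)
    then have "\<bar>C\<bar> * (1 / (real M * ((real M)\<^sup>2 - 1))) \<le> \<bar>C\<bar> * (2 * (1 / real M ^ 3))"
      by (intro mult_left_mono) auto
    then show ?case
      using pos by (simp add: abs_mult)
  qed
qed

theorem theorem1:
  fixes N :: nat and A Ts vm wl \<sigma>sq P \<beta>abs \<Delta> x1 :: real
  assumes "N \<ge> 2"
    and "A > 0" "Ts > 0" "vm > 0" "wl > 0" "\<sigma>sq > 0" "P > 0" "\<beta>abs > 0"
    and "\<Delta> = vm * Ts"
    and "A \<ge> (real N - 1) * \<Delta>"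
    and "0 \<le> x1" "x1 \<le> A - (real N - 1) * \<Delta>"
    \<comment> \<open>Quantified functions \<open>A'\<close>, \<open>s\<close> below: as the number of snapshots \<open>M\<close> grows, the segment length and
        starting position may vary with it, as long as the time-constrained regime is kept.\<close>
  shows "is_arg_min (\<lambda>(x, v). CRB \<sigma>sq wl P \<beta>abs N x) (\<lambda>(x, v). feasible A Ts vm N x v)
           (x_TC x1 \<Delta>, v_TC vm)
    \<and> CRB \<sigma>sq wl P \<beta>abs N (x_TC x1 \<Delta>)
           = ereal (3 * \<sigma>sq * wl\<^sup>2 / (2 * pi\<^sup>2 * P * \<beta>abs\<^sup>2 * \<Delta>\<^sup>2)
                      * (1 / (real N * ((real N)\<^sup>2 - 1))))
    \<and> (\<forall>A' s :: nat \<Rightarrow> real.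
           (\<forall>M\<ge>2. A' M \<ge> (real M - 1) * \<Delta> \<and> 0 \<le> s M \<and> s M \<le> A' M - (real M - 1) * \<Delta>) \<longrightarrow>
           (\<exists>g. (\<forall>M\<ge>2. CRB \<sigma>sq wl P \<beta>abs M (x_TC (s M) \<Delta>) = ereal (g M)) \<and>
                strict_antimono_on {2..} g \<and>
                g \<in> O(\<lambda>M. 1 / real M ^ 3)))"
proof -
  have "\<Delta> > 0" using assms by simp
  have "(real N)\<^sup>2 > 1" using assms by (intro one_less_power) auto
  then have var_pos: "pos_var N (x_TC x1 \<Delta>) > 0"
    using assms \<open>\<Delta> > 0\<close> by (simp add: pos_var_x_TC)
  have "CRB \<sigma>sq wl P \<beta>abs N (x_TC x1 \<Delta>) \<le> CRB \<sigma>sq wl P \<beta>abs N x" if "feasible A Ts vm N x v" for x v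
    using feasible_pos_var_le[OF that] assms var_pos by (intro CRB_antimono) auto
  then have "is_arg_min (\<lambda>(x, v). CRB \<sigma>sq wl P \<beta>abs N x) (\<lambda>(x, v). feasible A Ts vm N x v)
      (x_TC x1 \<Delta>, v_TC vm)"
    using feasible_x_TC assms by (force simp: is_arg_min_linorder)
  moreover have "3 * \<sigma>sq * wl\<^sup>2 / (2 * pi\<^sup>2 * P * \<beta>abs\<^sup>2 * \<Delta>\<^sup>2) > 0"
    using assms \<open>\<Delta> > 0\<close> by (auto intro!: divide_pos_pos mult_pos_pos)
  note strict_antimono_on_inverse_cubic[OF this]
  moreover have "CRB \<sigma>sq wl P \<beta>abs M (x_TC s' \<Delta>) =
      ereal (3 * \<sigma>sq * wl\<^sup>2 / (2 * pi\<^sup>2 * P * \<beta>abs\<^sup>2 * \<Delta>\<^sup>2) * (1 / (real M * ((real M)\<^sup>2 - 1))))"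
    if "M \<ge> 2" for M s'
    using CRB_x_TC that \<open>\<Delta> > 0\<close> by simp
  \<comment> \<open>The closed form depends neither on the segment length nor on the start, so one
    witness serves all \<open>A'\<close> and \<open>s\<close>.\<close>
  ultimately show ?thesis
    using \<open>N \<ge> 2\<close>
    by (intro conjI allI impI exI[where x = "\<lambda>M. 3 * \<sigma>sq * wl\<^sup>2 / (2 * pi\<^sup>2 * P * \<beta>abs\<^sup>2 * \<Delta>\<^sup>2) *
      (1 / (real M * ((real M)\<^sup>2 - 1)))"] inverse_cubic_bigo)
qed

end
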